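(* Let $\mathbb D=\{z\in\mathbb C:|z|<1\}$, and let $\lambda:\partial\mathbb D\to\mathbb C$ with $|\lambda(\zeta)|=1$ for all $\zeta\in\partial\mathbb D$, and $\varphi:\partial\mathbb D\to\mathbb R$ be Lebesgue measurable functions. Then there exists an analytic function $f:\mathbb D\to\mathbb C$ such that for almost every $\zeta\in\partial\mathbb D$ (with respect to arc length), $$\lim_{z\to\zeta}\ \mathrm{Re}\,\{\overline{\lambda(\zeta)}\cdot f(z)\}=\varphi(\zeta)$$ as $z\to\zeta$ along any nontangential path in $\mathbb D$ ending at $\zeta$.
   Context: A nontangential path in $\mathbb D$ ending at $\zeta\in\partial\mathbb D$ is a path in $\mathbb D$ tending to $\zeta$ and lying in some angular sector (Stolz angle) $\{z\in\mathbb D: |\arg(1-\bar\zeta z)|<\theta\}$ with $\theta<\pi/2$, near $\zeta$. *)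

theory Defs
  imports "HOL-Analysis.Analysis"
begin

definition nontangential_path :: "(real \<Rightarrow> complex) \<Rightarrow> complex \<Rightarrow> bool" where
  "nontangential_path \<gamma> \<zeta> \<longleftrightarrow>
     continuous_on {0..<1} \<gamma> \<and>
     \<gamma> ` {0..<1} \<subseteq> ball 0 1 \<and>
     (\<gamma> \<longlongrightarrow> \<zeta>) (at_left 1) \<and>
     (\<exists>\<theta>. 0 < \<theta> \<and> \<theta> < pi / 2 \<and>
        (\<forall>\<^sub>F t in at_left 1. \<bar>Arg (1 - cnj \<zeta> * \<gamma> t)\<bar> < \<theta>))"

end

theory Submission
  imports Defs "HOL-Complex_Analysis.Cauchy_Integral_Formula"
begin

text \<open>
  The function is a series of explicit correction terms. If \<open>|w| = 1\<close> and \<open>w \<noteq> 1\<close>, then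
  \<open>-2w / (1 - w)\<close> has real part 1. So if \<open>T(z) = P(z) / z\<^sup>m\<close> is a trigonometric polynomial close to
  \<open>\<lambda>R\<close> on most of the circle, where \<open>R\<close> is the current real residual, then
  \<open>f(z) = -2 T(z) z\<^sup>N / (1 - z\<^sup>N)\<close> satisfies \<open>Re (cnj \<lambda> f) \<approx> R\<close> there. For \<open>N\<close> large, \<open>f\<close> is
  holomorphic in the disc and tiny on a given compact subset. Moreover, off a set of small measure
  that consists of arcs around the \<open>N\<close>-th roots of unity, \<open>|f|\<close> is bounded in the Stolz angle at
  \<open>\<zeta>\<close> by \<open>K |R(\<zeta>)|\<close> up to a small error, with \<open>K\<close> independent of \<open>N\<close>. Hence, by Borel--Cantelli,
  the series of successive corrections converges uniformly in Stolz angles at almost every \<open>\<zeta>\<close>,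
  and the limits may be interchanged. Only the real part of \<open>cnj \<lambda> f\<close> can be prescribed: by
  Privalov's theorem the nontangential limit of \<open>f\<close> itself cannot.
\<close>

section \<open>Laurent expressions on the unit circle\<close>

text \<open>Restrictions to the circle of \<open>P z / z ^ m\<close> with \<open>P\<close> entire;
  \<open>q\<close> itself is unconstrained off the circle. The witness \<open>P\<close> extends the
  function into the disc, and \<open>z ^ m\<close> is later absorbed in a higher power of
  \<open>z\<close>.\<close>

definition circle_laurent :: "(complex \<Rightarrow> complex) \<Rightarrow> bool" where
  "circle_laurent q \<longleftrightarrow>
     (\<exists>m P. P holomorphic_on UNIV \<and> (\<forall>z. cmod z = 1 \<longrightarrow> P z = z ^ m * q z))"

lemma circle_laurent_const: "circle_laurent (\<lambda>z. c)"
  unfolding circle_laurent_def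
  by (rule exI[of _ 0], rule exI[of _ "\<lambda>z. c"]) (auto intro!: holomorphic_intros)

lemma circle_laurent_add:
  assumes "circle_laurent p" "circle_laurent q"
  shows "circle_laurent (\<lambda>z. p z + q z)"
proof -
  obtain m P n Q where "P holomorphic_on UNIV" "\<And>z. cmod z = 1 \<Longrightarrow> P z = z ^ m * p z"
    "Q holomorphic_on UNIV" "\<And>z. cmod z = 1 \<Longrightarrow> Q z = z ^ n * q z"
    using assms unfolding circle_laurent_def by metis
  then show ?thesis
    unfolding circle_laurent_def
    by (intro exI[of _ "m + n"] exI[of _ "\<lambda>z. z ^ n * P z + z ^ m * Q z"])
       (auto intro!: holomorphic_intros simp: power_add algebra_simps)
qed

lemma circle_laurent_mult:
  assumes "circle_laurent p" "circle_laurent q"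
  shows "circle_laurent (\<lambda>z. p z * q z)"
proof -
  obtain m P n Q where "P holomorphic_on UNIV" "\<And>z. cmod z = 1 \<Longrightarrow> P z = z ^ m * p z"
    "Q holomorphic_on UNIV" "\<And>z. cmod z = 1 \<Longrightarrow> Q z = z ^ n * q z"
    using assms unfolding circle_laurent_def by metis
  then show ?thesis
    unfolding circle_laurent_def
    by (intro exI[of _ "m + n"] exI[of _ "\<lambda>z. P z * Q z"])
       (auto intro!: holomorphic_intros simp: power_add algebra_simps)
qed

text \<open>On the circle \<open>cnj z = 1 / z\<close>, so \<open>Re z\<close> is
  \<open>(z + 1 / z) / 2\<close>, with a single power of \<open>z\<close> in the denominator. The
  imaginary part is treated in the same way.\<close>

lemma circle_laurent_Re: "circle_laurent (\<lambda>z. of_real (Re z))"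
proof -
  have "(z\<^sup>2 + 1) / 2 = z ^ 1 * of_real (Re z)" if "cmod z = 1" for z
  proof -
    have "z * cnj z = 1"
      using that complex_norm_square[of z] by simp
    moreover have "2 * complex_of_real (Re z) = z + cnj z"
      by (simp add: complex_add_cnj)
    ultimately show ?thesis
      by (simp add: field_simps power2_eq_square)
  qed
  then show ?thesis
    unfolding circle_laurent_def
    by (intro exI[of _ 1] exI[of _ "\<lambda>z. (z\<^sup>2 + 1) / 2"]) (auto intro!: holomorphic_intros)
qed

lemma circle_laurent_Im: "circle_laurent (\<lambda>z. of_real (Im z))"
proof -
  have "(z\<^sup>2 - 1) / (2 * \<i>) = z ^ 1 * of_real (Im z)" if "cmod z = 1" for z
  proof -
    have "z * cnj z = 1"
      using that complex_norm_square[of z] by simp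
    moreover have "2 * \<i> * complex_of_real (Im z) = z - cnj z"
      by (simp add: complex_diff_cnj)
    ultimately have "z * (2 * \<i> * of_real (Im z)) = z\<^sup>2 - 1"
      by (simp add: right_diff_distrib power2_eq_square)
    then show ?thesis
      by (simp add: field_simps)
  qed
  then show ?thesis
    unfolding circle_laurent_def
    by (intro exI[of _ 1] exI[of _ "\<lambda>z. (z\<^sup>2 - 1) / (2 * \<i>)"]) (auto intro!: holomorphic_intros)
qed

text \<open>Induction over the generators: a real linear functional on the plane is a combination of
  \<open>Re\<close> and \<open>Im\<close>, and constants, sums and products are closure
  properties.\<close>

lemma circle_laurent_real_polynomial:
  assumes "real_polynomial_function p"
  shows "circle_laurent (\<lambda>z. of_real (p z))"
  using assms
proof induction
  case (linear f)
  have "f z = Re z * f 1 + Im z * f \<i>" for z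
  proof -
    have "f z = f (Re z *\<^sub>R 1 + Im z *\<^sub>R \<i>)"
      by (rule arg_cong[of _ _ f]) (simp add: complex_eq_iff)
    then show ?thesis
      by (simp add: bounded_linear.linear[OF linear] linear_add linear_scale del: scaleR_one)
  qed
  then have "(\<lambda>z. complex_of_real (f z)) =
      (\<lambda>z. of_real (Re z) * of_real (f 1) + of_real (Im z) * of_real (f \<i>))"
    by (metis of_real_add of_real_mult)
  then show ?case
    by (simp only: circle_laurent_add circle_laurent_mult circle_laurent_const
        circle_laurent_Re circle_laurent_Im)
qed (simp_all add: circle_laurent_add circle_laurent_mult circle_laurent_const)

lemma circle_laurent_polynomial:
  assumes "polynomial_function (p :: complex \<Rightarrow> complex)"
  shows "circle_laurent p"
proof -
  have "real_polynomial_function (Re \<circ> p)" "real_polynomial_function (Im \<circ> p)"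
    using assms bounded_linear_Re bounded_linear_Im unfolding polynomial_function_def by blast+
  then have "circle_laurent (\<lambda>z. of_real (Re (p z)) + \<i> * of_real (Im (p z)))"
    using circle_laurent_real_polynomial
    by (intro circle_laurent_add circle_laurent_mult circle_laurent_const) force+
  then show ?thesis
    by (simp add: complex_eq[symmetric])
qed

section \<open>Approximation on the circle, uniform and then up to small measure\<close>

text \<open>Since \<open>g\<close> need not be periodic, an arc around 1 is cut out. On the
  remaining compact arc \<open>Arg2pi\<close> inverts \<open>cis\<close> continuously, and
  Stone-Weierstrass gives a polynomial in \<open>Re z\<close> and \<open>Im z\<close>, which is a
  Laurent expression on the circle.\<close>

lemma circle_approx_continuous:
  fixes g :: "real \<Rightarrow> complex"
  assumes "continuous_on UNIV g" "0 < \<eta>" "0 < \<tau>"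
  obtains P m where "P holomorphic_on UNIV"
    "\<And>t. t \<in> {\<eta>..2 * pi - \<eta>} \<Longrightarrow> cmod (P (cis t) - cis t ^ m * g t) \<le> \<tau>"
proof -
  let ?I = "{\<eta>..2 * pi - \<eta>}"
  have A: "Arg2pi (cis t) = t" if "t \<in> ?I" for t
    using that assms(2) Arg2pi_exp[of "\<i> * of_real t"] by (simp add: cis_conv_exp)
  have "continuous_on (cis ` ?I) Arg2pi"
    by (rule continuous_on_inv) (auto intro!: continuous_intros simp: A)
  then have "continuous_on (cis ` ?I) (\<lambda>z. g (Arg2pi z))"
    using assms(1) continuous_on_compose2 by blast
  moreover have "compact (cis ` ?I)"
    by (intro compact_continuous_image continuous_intros compact_Icc)
  ultimately obtain q where q: "polynomial_function q"
    "\<And>z. z \<in> cis ` ?I \<Longrightarrow> cmod (g (Arg2pi z) - q z) < \<tau>"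
    using Stone_Weierstrass_polynomial_function[OF _ _ assms(3)] by metis
  obtain m P where P: "P holomorphic_on UNIV" "\<And>z. cmod z = 1 \<Longrightarrow> P z = z ^ m * q z"
    using circle_laurent_polynomial[OF q(1)] unfolding circle_laurent_def by metis
  show thesis
  proof
    show "P holomorphic_on UNIV" by fact
    fix t assume t: "t \<in> ?I"
    have "P (cis t) - cis t ^ m * g t = cis t ^ m * (q (cis t) - g t)"
      by (simp add: P(2) algebra_simps)
    then have "cmod (P (cis t) - cis t ^ m * g t) = cmod (g t - q (cis t))"
      by (simp add: norm_mult norm_power norm_minus_commute)
    also have "\<dots> < \<tau>"
      using q(2)[of "cis t"] t A by auto
    finally show "cmod (P (cis t) - cis t ^ m * g t) \<le> \<tau>" by simp
  qed
qed

text \<open>A measurable function is an almost everywhere limit of continuous ones, hence a limit in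
  measure on the bounded interval; one of these continuous functions is then approximated off the
  ends of the interval.\<close>

lemma circle_approx_measurable:
  fixes h :: "real \<Rightarrow> complex"
  assumes h: "h \<in> borel_measurable lebesgue" and "0 < \<mu>" "0 < \<tau>"
  obtains P m E where "P holomorphic_on UNIV" "E \<in> lmeasurable" "measure lebesgue E \<le> \<mu>"
    "\<And>t. t \<in> {0..2 * pi} - E \<Longrightarrow> cmod (P (cis t) - cis t ^ m * h t) \<le> \<tau>"
proof -
  obtain N g where N: "negligible N" and cont: "\<And>n. continuous_on UNIV (g n)"
    and lim: "\<And>x. x \<notin> N \<Longrightarrow> (\<lambda>n. g n x) \<longlonglongrightarrow> h x"
    using lebesgue_measurable_imp_measurable_on[OF h] unfolding measurable_on_def by force
  define B where "B n = {t \<in> {0..2 * pi}. \<tau> / 2 < cmod (g n t - h t)}" for n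
  have gm: "g n \<in> borel_measurable lebesgue" for n
    by (intro measurable_completion) (simp add: borel_measurable_continuous_onI cont)
  have Bsets: "B n \<in> sets lebesgue" for n
  proof -
    have "(\<lambda>t. cmod (g n t - h t)) \<in> borel_measurable lebesgue"
      using gm h by measurable
    then have S: "{t \<in> space lebesgue. \<tau> / 2 < cmod (g n t - h t)} \<in> sets lebesgue"
      by measurable
    have eq: "B n = {0..2 * pi} \<inter> {t \<in> space lebesgue. \<tau> / 2 < cmod (g n t - h t)}"
      by (auto simp: B_def)
    show ?thesis
      unfolding eq by (rule sets.Int[OF _ S]) simp
  qed
  have Bm: "B n \<in> lmeasurable" for n
  proof (rule fmeasurableI2[OF _ _ Bsets])
    show "{0..2 * pi} \<in> lmeasurable" by simp
    show "B n \<subseteq> {0..2 * pi}" by (auto simp: B_def)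
  qed
  \<comment> \<open>Dominated convergence for the indicators turns pointwise convergence off
    \<open>N\<close> into convergence of the measures of the bad sets to 0.\<close>
  have "(\<lambda>n. LINT t|lebesgue. indicator (B n) t) \<longlonglongrightarrow> (LINT t|(lebesgue::real measure). (0::real))"
  proof (rule integral_dominated_convergence)
    show "integrable lebesgue (indicator {0..2 * pi} :: real \<Rightarrow> real)"
      by (simp add: fmeasurable_def[symmetric] integrable_indicator_iff)
    show "AE t in lebesgue. (\<lambda>n. indicator (B n) t) \<longlonglongrightarrow> (0::real)"
    proof (rule AE_I')
      show "N \<in> null_sets lebesgue" using N negligible_iff_null_sets by blast
      have "(\<lambda>n. indicator (B n) t) \<longlonglongrightarrow> (0::real)" if "t \<notin> N" for t
      proof (rule tendsto_eventually)
        have "\<forall>\<^sub>F n in sequentially. dist (g n t) (h t) < \<tau> / 2"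
          using tendstoD[OF lim[OF that], of "\<tau> / 2"] assms(3) by simp
        then show "\<forall>\<^sub>F n in sequentially. indicator (B n) t = (0::real)"
          by eventually_elim (auto simp: B_def dist_norm)
      qed
      then show "{t \<in> space lebesgue. \<not> (\<lambda>n. indicator (B n) t) \<longlonglongrightarrow> (0::real)} \<subseteq> N"
        by blast
    qed
    show "AE t in lebesgue. norm (indicator (B n) t :: real) \<le> indicator {0..2 * pi} t" for n
      by (auto simp: B_def indicator_def)
    show "(\<lambda>t. indicator (B n) t :: real) \<in> borel_measurable lebesgue" for n
      using Bsets by auto
  qed auto
  then have "(\<lambda>n. measure lebesgue (B n)) \<longlonglongrightarrow> 0"
    by simp
  then have "\<forall>\<^sub>F n in sequentially. measure lebesgue (B n) < \<mu> / 2"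
    using assms(2) by (intro order_tendstoD(2)) auto
  then obtain n where n: "measure lebesgue (B n) < \<mu> / 2"
    by (auto simp: eventually_sequentially)
  \<comment> \<open>The two end intervals have total length \<open>\<mu> / 2\<close>, which is what
    the bad set leaves over.\<close>
  define \<eta> where "\<eta> = \<mu> / 4"
  define E where "E = B n \<union> ({0..\<eta>} \<union> {2 * pi - \<eta>..2 * pi})"
  obtain P m where P: "P holomorphic_on UNIV"
    "\<And>t. t \<in> {\<eta>..2 * pi - \<eta>} \<Longrightarrow> cmod (P (cis t) - cis t ^ m * g n t) \<le> \<tau> / 2"
    using circle_approx_continuous[OF cont, of \<eta> "\<tau> / 2"] assms by (auto simp: \<eta>_def)
  show thesis
  proof
    show "P holomorphic_on UNIV" by fact
    show "E \<in> lmeasurable"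
      using Bm unfolding E_def by (intro fmeasurable.Un) auto
    have "measure lebesgue E \<le> measure lebesgue (B n) +
        measure lebesgue ({0..\<eta>} \<union> {2 * pi - \<eta>..2 * pi})"
      unfolding E_def using Bsets by (intro measure_Un_le) auto
    also have "measure lebesgue ({0..\<eta>} \<union> {2 * pi - \<eta>..2 * pi}) \<le>
        measure lebesgue {0..\<eta>} + measure lebesgue {2 * pi - \<eta>..2 * pi}"
      by (intro measure_Un_le) auto
    finally show "measure lebesgue E \<le> \<mu>"
      using n assms(2) by (simp add: \<eta>_def)
    fix t assume t: "t \<in> {0..2 * pi} - E"
    then have "cmod (g n t - h t) \<le> \<tau> / 2" "t \<in> {\<eta>..2 * pi - \<eta>}"
      by (auto simp: E_def B_def)
    moreover have eq: "P (cis t) - cis t ^ m * h t =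
        (P (cis t) - cis t ^ m * g n t) + cis t ^ m * (g n t - h t)"
      by (simp add: algebra_simps)
    ultimately show "cmod (P (cis t) - cis t ^ m * h t) \<le> \<tau>"
      using norm_triangle_ineq[of "P (cis t) - cis t ^ m * g n t" "cis t ^ m * (g n t - h t)"] P(2)[of t]
      unfolding eq by (simp add: norm_mult norm_power)
  qed
qed

section \<open>Lower bounds for \<open>1 - z ^ N\<close> on the circle and in Stolz angles\<close>

text \<open>Intervals of radius \<open>\<eta> / N\<close> around the angles of the
  \<open>N\<close>-th roots of unity are removed. There are \<open>N + 1 \<le> 2 * N\<close> of
  them, so the bound on the measure does not depend on \<open>N\<close>.\<close>

lemma circle_power_avoid:
  assumes "0 < \<eta>" "\<eta> \<le> pi" "0 < N"
  obtains E where "E \<in> lmeasurable" "measure lebesgue E \<le> 4 * \<eta>"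
    "\<And>t. t \<in> {0..2 * pi} - E \<Longrightarrow> 1 - cos \<eta> \<le> cmod (1 - cis t ^ N)"
proof
  let ?E = "\<Union>k\<le>N. cball (2 * pi * real k / real N) (\<eta> / real N)"
  show "?E \<in> lmeasurable" by auto
  have "measure lebesgue ?E \<le> (\<Sum>k\<le>N. measure lebesgue (cball (2 * pi * real k / real N) (\<eta> / real N)))"
    by (rule measure_UNION_le) auto
  also have "\<dots> = (\<Sum>k\<le>N. 2 * \<eta> / real N)"
    using assms by (intro sum.cong refl) (simp add: cball_eq_atLeastAtMost divide_simps)
  also have "\<dots> \<le> 4 * \<eta>"
    using assms by (simp add: field_simps)
  finally show "measure lebesgue ?E \<le> 4 * \<eta>" .
  fix t assume t: "t \<in> {0..2 * pi} - ?E"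
  \<comment> \<open>\<open>k\<close> indexes the nearest root of unity and \<open>y\<close> is the
    angle \<open>N * t\<close> reduced to modulus at most \<open>pi\<close>, where cosine decreases
    in \<open>\<bar>y\<bar>\<close>.\<close>
  define k where "k = nat (round (real N * t / (2 * pi)))"
  define y where "y = real N * t - 2 * pi * real k"
  have t0: "0 \<le> real N * t / (2 * pi)" "real N * t / (2 * pi) \<le> real N"
    using t assms by (auto simp: field_simps)
  have "0 \<le> round (real N * t / (2 * pi))"
    using round_mono[OF t0(1)] by simp
  then have k: "real k = of_int (round (real N * t / (2 * pi)))"
    by (simp add: k_def)
  have "round (real N * t / (2 * pi)) \<le> int N"
    using round_mono[OF t0(2)] by simp
  then have "k \<le> N" by (simp add: k_def)
  then have "\<eta> / real N < \<bar>t - 2 * pi * real k / real N\<bar>"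
    using t by (force simp: dist_real_def abs_minus_commute not_le)
  also have "t - 2 * pi * real k / real N = y / real N"
    using assms by (simp add: y_def field_simps)
  finally have y1: "\<eta> < \<bar>y\<bar>"
    using assms by (simp add: field_simps)
  have "\<bar>real k - real N * t / (2 * pi)\<bar> \<le> 1 / 2"
    unfolding k by (rule of_int_round_abs_le)
  moreover have "y = - (2 * pi) * (real k - real N * t / (2 * pi))"
    by (simp add: y_def field_simps)
  ultimately have y2: "\<bar>y\<bar> \<le> pi"
    using mult_left_mono[of "\<bar>real k - real N * t / (2 * pi)\<bar>" "1 / 2" "2 * pi"]
    by (simp add: abs_mult)
  have "cos (real N * t) = cos (y + 2 * pi * real k)"
    by (simp add: y_def)
  also have "\<dots> = cos \<bar>y\<bar>"
    using cos.plus_of_nat[of y k] by (simp add: mult.commute)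
  also have "\<dots> \<le> cos \<eta>"
    using y1 y2 assms by (intro cos_monotone_0_pi_le) auto
  finally have "1 - cos \<eta> \<le> Re (1 - cis t ^ N)"
    by (simp add: Complex.DeMoivre)
  also have "\<dots> \<le> cmod (1 - cis t ^ N)"
    by (rule complex_Re_le_cmod)
  finally show "1 - cos \<eta> \<le> cmod (1 - cis t ^ N)" .
qed

text \<open>
  If \<open>N (1 - |z|)\<close> is small, then \<open>z ^ N\<close> is close to \<open>\<zeta> ^ N\<close>; otherwise \<open>|z| ^ N\<close> is bounded away from 1.
\<close>

lemma stolz_power_gap:
  assumes "cmod z < 1" "cmod \<zeta> = 1" "cmod (z - \<zeta>) \<le> A * (1 - cmod z)" "1 \<le> A"
    and "0 < c" "c \<le> cmod (1 - \<zeta> ^ N)"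
  shows "c / (2 * A + c) \<le> cmod (1 - z ^ N)"
proof -
  define x where "x = real N * (1 - cmod z)"
  have x: "0 \<le> x" using assms by (simp add: x_def)
  have "cmod (\<zeta> ^ N - z ^ N) \<le> real N * cmod (\<zeta> - z)"
    using assms by (intro norm_power_diff) auto
  also have "\<dots> \<le> A * x"
    using mult_left_mono[OF assms(3), of "real N"] by (simp add: x_def norm_minus_commute algebra_simps)
  finally have near: "c - A * x \<le> cmod (1 - z ^ N)"
    using norm_triangle_ineq2[of "1 - \<zeta> ^ N" "z ^ N - \<zeta> ^ N"] assms(6)
    by (simp add: norm_minus_commute)
  show ?thesis
  proof (cases "A * x \<le> c / 2")
    case True
    have "c / (2 * A + c) \<le> c / 2"
      using assms by (intro divide_left_mono) auto
    then show ?thesis using near True by linarith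
  next
    case False
    \<comment> \<open>Bernoulli's inequality, multiplied by \<open>cmod z ^ N\<close>, gives
      \<open>cmod z ^ N \<le> 1 / (1 + x)\<close>, because
      \<open>s * (2 - s) = 1 - (1 - s)^2\<close> is at most 1.\<close>
    have "1 + x \<le> (1 + (1 - cmod z)) ^ N"
      using Bernoulli_inequality[of "1 - cmod z" N] assms by (simp add: x_def)
    then have "cmod z ^ N * (1 + x) \<le> (cmod z * (2 - cmod z)) ^ N"
      by (simp add: power_mult_distrib mult_left_mono)
    also have "\<dots> \<le> 1"
    proof (rule power_le_one)
      show "cmod z * (2 - cmod z) \<le> 1"
        using zero_le_power2[of "1 - cmod z"] by (simp add: power2_eq_square algebra_simps)
    qed (use assms in auto)
    finally have "x \<le> (1 - cmod z ^ N) * (1 + x)"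
      by (simp add: algebra_simps)
    then have far: "x / (1 + x) \<le> 1 - cmod z ^ N"
      using x by (simp add: divide_le_eq)
    \<comment> \<open>Here \<open>x > c / (2 * A)\<close>; the increasing function
      \<open>x / (1 + x)\<close> takes exactly the value \<open>c / (2 * A + c)\<close> at that
      threshold.\<close>
    have "c / (2 * A + c) \<le> x / (1 + x)"
      using False assms x by (simp add: field_simps)
    also have "\<dots> \<le> cmod (1 - z ^ N)"
      using far norm_triangle_ineq2[of 1 "z ^ N"] by (simp add: norm_power)
    finally show ?thesis .
  qed
qed

section \<open>Construction of one correction\<close>

text \<open>With \<open>cnj w = 1 / w\<close>, the conjugate of \<open>-2 * w / (1 - w)\<close> is
  \<open>2 / (1 - w)\<close>, and the two add up to 2.\<close>

lemma Re_unit_multiplier: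
  assumes "cmod w = 1" "w \<noteq> 1"
  shows "Re (w * (-2 / (1 - w))) = 1"
proof -
  have w: "w * cnj w = 1" "w \<noteq> 0"
    using assms complex_norm_square[of w] by auto
  then have cw: "cnj w = 1 / w" by (simp add: field_simps)
  have "w * (-2 / (1 - w)) + cnj (w * (-2 / (1 - w))) = 2"
    using w(2) assms(2) by (simp add: cw divide_simps) (simp add: algebra_simps)
  then have "complex_of_real (2 * Re (w * (-2 / (1 - w)))) = complex_of_real 2"
    by (simp only: complex_add_cnj of_real_numeral)
  then show ?thesis
    by (simp only: of_real_eq_iff) 
qed


text \<open>
  The constant \<open>K\<close> is found before the residual \<open>R\<close> and the tolerance \<open>\<tau>\<close> are given, so that each
  tolerance can be chosen in terms of the constant of the following correction.
\<close>

definition stolz_correction ::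
  "real \<Rightarrow> real \<Rightarrow> real \<Rightarrow> real \<Rightarrow> (real \<Rightarrow> complex) \<Rightarrow> (real \<Rightarrow> real) \<Rightarrow> real \<Rightarrow>
    (complex \<Rightarrow> complex) \<Rightarrow> real set \<Rightarrow> bool" where
  "stolz_correction A \<mu> r K lam R \<tau> f E \<longleftrightarrow>
     f holomorphic_on ball 0 1 \<and> (\<lambda>t. f (cis t)) \<in> borel_measurable lebesgue \<and>
     negligible {t. \<not> isCont f (cis t)} \<and> (\<forall>z. cmod z \<le> r \<longrightarrow> cmod (f z) \<le> \<tau>) \<and>
     E \<in> lmeasurable \<and> measure lebesgue E \<le> \<mu> \<and>
     (\<forall>t\<in>{0..2 * pi} - E. \<bar>R t - Re (cnj (lam t) * f (cis t))\<bar> \<le> \<tau> \<and>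
       (\<forall>z\<in>ball 0 1. cmod (z - cis t) \<le> A * (1 - cmod z) \<longrightarrow> cmod (f z) \<le> K * \<bar>R t\<bar> + \<tau>))"

text \<open>The order of choices matters: \<open>K\<close> depends only on \<open>A\<close> and
  \<open>\<mu>\<close>, then \<open>P\<close> and \<open>m\<close> on \<open>R\<close> and
  \<open>\<tau>\<close>, and last the exponent \<open>j\<close>, large enough for
  \<open>z ^ j\<close> to suppress \<open>P\<close> away from the circle.\<close>

lemma stolz_correction_exists:
  assumes "1 \<le> A" "0 < \<mu>" and r: "r < 1"
    and lam: "lam \<in> borel_measurable lebesgue" "\<And>t. cmod (lam t) = 1"
  obtains K where "0 < K"
    "\<And>R \<tau>. R \<in> borel_measurable lebesgue \<Longrightarrow> 0 < \<tau> \<Longrightarrow>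
      \<exists>f E. stolz_correction A \<mu> r K lam R \<tau> f E"
proof -
  \<comment> \<open>Half of \<open>\<mu>\<close> goes to the neighbourhoods of the roots of unity,
    half to the approximation.\<close>
  define \<eta> where "\<eta> = min (\<mu> / 8) pi"
  define c where "c = 1 - cos \<eta>"
  \<comment> \<open>The lower bound of \<open>stolz_power_gap\<close>; thus \<open>K\<close> bounds
    \<open>2 / cmod (1 - z ^ N)\<close> in the Stolz angle, and also at its vertex because
    \<open>\<kappa> \<le> c\<close>.\<close>
  define \<kappa> where "\<kappa> = c / (2 * A + c)"
  define K where "K = 2 / \<kappa>"
  have \<eta>: "0 < \<eta>" "\<eta> \<le> pi" "4 * \<eta> \<le> \<mu> / 2"
    using assms by (auto simp: \<eta>_def)
  have "cos \<eta> < cos 0"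
    using \<eta> by (intro cos_monotone_0_pi) auto
  then have c: "0 < c" by (simp add: c_def)
  have \<kappa>: "0 < \<kappa>" "\<kappa> \<le> c"
    using c assms by (auto simp: \<kappa>_def divide_le_eq)
  have K: "0 < K" using \<kappa> by (simp add: K_def)
  show thesis
  proof (rule that[OF K])
    fix R :: "real \<Rightarrow> real" and \<tau> :: real
    assume R: "R \<in> borel_measurable lebesgue" and \<tau>: "0 < \<tau>"
    define \<tau>' where "\<tau>' = \<tau> / (2 * K + 2)"
    have \<tau>': "0 < \<tau>'" "2 * K * \<tau>' \<le> \<tau>" "\<tau>' * K \<le> \<tau>"
      using \<tau> K by (auto simp: \<tau>'_def field_simps)
    have lamR: "(\<lambda>t. lam t * of_real (R t)) \<in> borel_measurable lebesgue"
      using lam(1) R by measurable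
    obtain P m E1 where P: "P holomorphic_on UNIV"
      and E1: "E1 \<in> lmeasurable" "measure lebesgue E1 \<le> \<mu> / 2"
      and approx: "\<And>t. t \<in> {0..2 * pi} - E1 \<Longrightarrow>
        cmod (P (cis t) - cis t ^ m * (lam t * of_real (R t))) \<le> \<tau>'"
      using circle_approx_measurable[OF lamR half_gt_zero[OF assms(2)] \<tau>'(1)] by blast
    have contP: "continuous_on S P" for S
      using P holomorphic_on_imp_continuous_on continuous_on_subset by blast
    have "uniformly_continuous_on (cball 0 1) P"
      by (intro compact_uniformly_continuous contP) auto
    then obtain d where d: "0 < d"
      "\<And>z w. cmod z \<le> 1 \<Longrightarrow> cmod w \<le> 1 \<Longrightarrow> cmod (z - w) < d \<Longrightarrow> cmod (P z - P w) < \<tau>'"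
      using \<tau>'(1) unfolding uniformly_continuous_on_def by (force simp: dist_norm)
    have "bounded (P ` cball 0 1)"
      by (intro compact_imp_bounded compact_continuous_image contP) auto
    then obtain M where M: "0 < M" "\<And>z. cmod z \<le> 1 \<Longrightarrow> cmod (P z) \<le> M"
      unfolding bounded_pos by auto
    \<comment> \<open>A point of the Stolz angle at distance at least \<open>d\<close> from its
      vertex has modulus at most \<open>1 - d / A\<close>. So the disc of radius
      \<open>\<rho>\<close> contains these points as well as the disc of radius
      \<open>r\<close>.\<close>
    define \<rho> where "\<rho> = max r (max 0 (1 - d / A))"
    have \<rho>: "0 \<le> \<rho>" "\<rho> < 1" "r \<le> \<rho>" "1 - d / A \<le> \<rho>"
      using r d(1) assms(1) by (auto simp: \<rho>_def)
    have "(\<lambda>n. (2 * M / (1 - \<rho>) + K * M) * \<rho> ^ n) \<longlonglongrightarrow> 0"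
      using \<rho> LIMSEQ_realpow_zero[of \<rho>] by (intro tendsto_mult_right_zero) auto
    then have "\<forall>\<^sub>F n in sequentially. (2 * M / (1 - \<rho>) + K * M) * \<rho> ^ n < \<tau>"
      using \<tau> by (rule order_tendstoD)
    \<comment> \<open>A successor exponent makes \<open>N\<close> positive even if
      \<open>m = 0\<close>.\<close>
    then obtain j where "(2 * M / (1 - \<rho>) + K * M) * \<rho> ^ Suc j < \<tau>"
      unfolding eventually_sequentially using le_Suc_eq by blast
    then obtain j where j: "0 < j" "(2 * M / (1 - \<rho>) + K * M) * \<rho> ^ j < \<tau>"
      by blast
    have j1: "2 * M / (1 - \<rho>) * \<rho> ^ j \<le> \<tau>" and j2: "K * M * \<rho> ^ j \<le> \<tau>"
    proof -
      have "0 \<le> 2 * M / (1 - \<rho>) * \<rho> ^ j" "0 \<le> K * M * \<rho> ^ j"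
        using M(1) K \<rho> by auto
      then show "2 * M / (1 - \<rho>) * \<rho> ^ j \<le> \<tau>" "K * M * \<rho> ^ j \<le> \<tau>"
        using j(2) by (simp_all add: distrib_right)
    qed
    define N where "N = m + j"
    have N: "0 < N" using j by (simp add: N_def)
    obtain E2 where E2: "E2 \<in> lmeasurable" "measure lebesgue E2 \<le> 4 * \<eta>"
      "\<And>t. t \<in> {0..2 * pi} - E2 \<Longrightarrow> c \<le> cmod (1 - cis t ^ N)"
      using circle_power_avoid[OF \<eta>(1,2) N] unfolding c_def by blast
    \<comment> \<open>With \<open>N = m + j\<close> this is
      \<open>-2 * T * z ^ N / (1 - z ^ N)\<close> for \<open>T = P z / z ^ m\<close>. The same
      formula gives the values on the circle; division by zero makes it 0 at the \<open>N\<close>-th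
      roots of unity.\<close>
    define f where "f z = P z * z ^ j * (-2 / (1 - z ^ N))" for z :: complex
    have fnorm: "cmod (f z) = cmod (P z) * cmod z ^ j * (2 / cmod (1 - z ^ N))" for z
      by (simp add: f_def norm_mult norm_divide norm_power)
    have gap0: "1 - cmod z \<le> cmod (1 - z ^ N)" if "cmod z \<le> 1" for z :: complex
    proof -
      have "cmod z ^ N \<le> cmod z ^ 1"
        using that N by (intro power_decreasing) auto
      then show ?thesis
        using norm_triangle_ineq2[of 1 "z ^ N"] by (simp add: norm_power)
    qed
    have hol: "f holomorphic_on ball 0 1"
    proof -
      have "1 - z ^ N \<noteq> 0" if "z \<in> ball 0 1" for z :: complex
        using gap0[of z] that by auto
      then show ?thesis
        unfolding f_def by (intro holomorphic_intros holomorphic_on_subset[OF P]) auto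
    qed
    have meas: "(\<lambda>t. f (cis t)) \<in> borel_measurable lebesgue"
    proof -
      have "P \<in> borel_measurable borel" "cis \<in> borel_measurable borel"
        by (auto intro!: borel_measurable_continuous_onI contP continuous_intros)
      then have "(\<lambda>t. f (cis t)) \<in> borel_measurable lborel"
        unfolding f_def by measurable
      then show ?thesis by (rule measurable_completion)
    qed
    have negl: "negligible {t. \<not> isCont f (cis t)}"
    proof (rule negligible_subset)
      show "negligible (range (\<lambda>n::int. 2 * pi * of_int n / real N))"
        unfolding negligible_iff_null_sets
        by (intro null_sets_completionI countable_imp_null_set_lborel countable_image) auto
      show "{t. \<not> isCont f (cis t)} \<subseteq> range (\<lambda>n::int. 2 * pi * of_int n / real N)"
      proof clarify
        fix t assume nc: "\<not> isCont f (cis t)"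
        have "isCont P (cis t)"
          using contP[of UNIV] continuous_on_eq_continuous_at by blast
        then have "1 - cis t ^ N = 0"
          using nc unfolding f_def by (auto intro!: continuous_intros)
        then have "cis (real N * t) = 1"
          by (simp add: Complex.DeMoivre)
        then have "cos (real N * t) = 1"
          by (simp add: complex_eq_iff)
        then obtain n :: int where "real N * t = of_int n * 2 * pi"
          unfolding cos_one_2pi_int by auto
        then have "t = 2 * pi * of_int n / real N"
          using N by (simp add: field_simps)
        then show "t \<in> range (\<lambda>n::int. 2 * pi * of_int n / real N)" by blast
      qed
    qed
    have small: "cmod (f z) \<le> \<tau>" if z: "cmod z \<le> r" for z
    proof -
      have z1: "cmod z \<le> \<rho>" using z \<rho> by simp
      have "1 - \<rho> \<le> cmod (1 - z ^ N)"
        using gap0[of z] z1 \<rho> by simp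
      then have "cmod (f z) \<le> M * \<rho> ^ j * (2 / (1 - \<rho>))"
        unfolding fnorm using z1 \<rho> M(1)
        by (intro mult_mono M power_mono divide_left_mono) (auto intro!: mult_pos_pos)
      then show ?thesis using j1 by (simp add: mult_ac)
    qed
    have bound: "\<bar>R t - Re (cnj (lam t) * f (cis t))\<bar> \<le> \<tau>"
      "\<And>z. z \<in> ball 0 1 \<Longrightarrow> cmod (z - cis t) \<le> A * (1 - cmod z) \<Longrightarrow> cmod (f z) \<le> K * \<bar>R t\<bar> + \<tau>"
      if t: "t \<in> {0..2 * pi} - (E1 \<union> E2)" for t
    proof -
      let ?\<zeta> = "cis t"
      define D where "D = P ?\<zeta> - ?\<zeta> ^ m * (lam t * of_real (R t))"
      define s where "s = -2 / (1 - ?\<zeta> ^ N)"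
      have D: "cmod D \<le> \<tau>'" using approx t by (simp add: D_def)
      have gap: "c \<le> cmod (1 - ?\<zeta> ^ N)" using E2(3) t by blast
      then have ne: "?\<zeta> ^ N \<noteq> 1" using c by auto
      have s: "cmod s \<le> K"
        unfolding s_def K_def norm_divide using gap c \<kappa>
        by (auto intro!: divide_left_mono mult_pos_pos)
      have lam1: "cnj (lam t) * lam t = 1"
        using lam(2) complex_norm_square[of "lam t"] by (simp add: mult.commute)
      have "f ?\<zeta> = (D + ?\<zeta> ^ m * (lam t * of_real (R t))) * ?\<zeta> ^ j * s"
        by (simp add: f_def s_def D_def)
      \<comment> \<open>The main term has real part exactly \<open>R t\<close>, since
        \<open>\<zeta> ^ N * s\<close> has real part 1; the error is the contribution of
        \<open>D\<close>.\<close>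
      then have "cnj (lam t) * f ?\<zeta> =
          (cnj (lam t) * lam t) * of_real (R t) * (?\<zeta> ^ N * s) + cnj (lam t) * D * ?\<zeta> ^ j * s"
        by (simp add: N_def power_add distrib_left distrib_right mult_ac)
      then have "cnj (lam t) * f ?\<zeta> =
          of_real (R t) * (?\<zeta> ^ N * s) + cnj (lam t) * D * ?\<zeta> ^ j * s"
        by (simp only: lam1 mult_1)
      moreover have "Re (?\<zeta> ^ N * s) = 1"
        unfolding s_def using ne by (intro Re_unit_multiplier) (simp_all add: norm_power)
      moreover have "Re (of_real x * u + v) = x * Re u + Re v" for x u v
        by simp
      ultimately have "R t - Re (cnj (lam t) * f ?\<zeta>) = - Re (cnj (lam t) * D * ?\<zeta> ^ j * s)"
        by simp
      also have "\<bar>\<dots>\<bar> \<le> cmod (cnj (lam t) * D * ?\<zeta> ^ j * s)"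
        unfolding abs_minus_cancel by (rule abs_Re_le_cmod)
      also have "\<dots> = cmod D * cmod s"
        using lam(2) by (simp add: norm_mult norm_power)
      also have "\<dots> \<le> \<tau>' * K"
        using D s \<tau>'(1) by (intro mult_mono) auto
      finally show "\<bar>R t - Re (cnj (lam t) * f ?\<zeta>)\<bar> \<le> \<tau>"
        using \<tau>'(3) by simp
      fix z assume z: "z \<in> ball 0 1" "cmod (z - ?\<zeta>) \<le> A * (1 - cmod z)"
      have z1: "cmod z < 1" using z by simp
      have "\<kappa> \<le> cmod (1 - z ^ N)"
        unfolding \<kappa>_def using z1 z(2) assms(1) c gap by (intro stolz_power_gap[of z ?\<zeta>]) auto
      then have q: "2 / cmod (1 - z ^ N) \<le> K"
        unfolding K_def using \<kappa> by (intro divide_left_mono) (auto intro!: mult_pos_pos)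
      show "cmod (f z) \<le> K * \<bar>R t\<bar> + \<tau>"
      \<comment> \<open>Near the vertex uniform continuity compares \<open>P z\<close> with
        \<open>P\<close> at the vertex; farther away \<open>cmod z \<le> \<rho>\<close>, so
        \<open>z ^ j\<close> is small.\<close>
      proof (cases "cmod (z - ?\<zeta>) < d")
        case True
        have "cmod (P ?\<zeta>) \<le> cmod D + cmod (?\<zeta> ^ m * (lam t * of_real (R t)))"
          using norm_triangle_ineq[of D "?\<zeta> ^ m * (lam t * of_real (R t))"] by (simp add: D_def)
        also have "\<dots> \<le> \<tau>' + \<bar>R t\<bar>"
          using D lam(2) by (simp add: norm_mult norm_power)
        finally have "cmod (P z) \<le> \<bar>R t\<bar> + 2 * \<tau>'"
          using d(2)[of z ?\<zeta>] True z1 norm_triangle_ineq2[of "P z" "P ?\<zeta>"] by simp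
        then have "cmod (f z) \<le> (\<bar>R t\<bar> + 2 * \<tau>') * 1 * K"
          unfolding fnorm using z1 \<tau>'(1) q
          by (intro mult_mono power_le_one) auto
        then show ?thesis using \<tau>'(2) by (simp add: algebra_simps)
      next
        case False
        then have "d / A \<le> 1 - cmod z"
          using z(2) assms(1) by (simp add: divide_le_eq mult.commute)
        then have "cmod z \<le> \<rho>" using \<rho>(4) by simp
        then have "cmod (f z) \<le> M * \<rho> ^ j * K"
          unfolding fnorm using z1 \<rho> q M(1)
          by (intro mult_mono M power_mono) auto
        also have "\<dots> \<le> \<tau>"
          using j2 by (simp add: mult_ac)
        finally show ?thesis using K by (simp add: add_increasing)
      qed
    qed
    have "E1 \<union> E2 \<in> lmeasurable"
      using E1 E2 by (intro fmeasurable.Un)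
    moreover have "measure lebesgue (E1 \<union> E2) \<le> \<mu>"
      using measure_Un_le[of E1 lebesgue E2] E1 E2 \<eta>(3) by (simp add: fmeasurableD)
    ultimately have "stolz_correction A \<mu> r K lam R \<tau> f (E1 \<union> E2)"
      unfolding stolz_correction_def using hol meas negl small bound by blast
    then show "\<exists>f E. stolz_correction A \<mu> r K lam R \<tau> f E" by blast
  qed
qed

section \<open>Nontangential approach and reduction to one period\<close>

text \<open>For \<open>v = 1 - cnj \<zeta> * z\<close> one has
  \<open>(cmod z)^2 = 1 - 2 * Re v + (cmod v)^2\<close>, and the sector gives
  \<open>Re v \<ge> cos \<theta> * cmod v\<close>. Once \<open>cmod v < cos \<theta>\<close>, half
  of the linear gain absorbs the quadratic term.\<close>

lemma nontangential_path_stolz: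
  assumes "nontangential_path \<gamma> \<zeta>" "cmod \<zeta> = 1"
  obtains A where "\<forall>\<^sub>F s in at_left 1. \<gamma> s \<in> ball 0 1 \<and> cmod (\<gamma> s - \<zeta>) \<le> A * (1 - cmod (\<gamma> s))"
proof -
  obtain \<theta> where \<theta>: "0 < \<theta>" "\<theta> < pi / 2" "\<forall>\<^sub>F t in at_left 1. \<bar>Arg (1 - cnj \<zeta> * \<gamma> t)\<bar> < \<theta>"
    and img: "\<gamma> ` {0..<1} \<subseteq> ball 0 1" and lim: "(\<gamma> \<longlongrightarrow> \<zeta>) (at_left 1)"
    using assms(1) unfolding nontangential_path_def by blast
  have cos: "0 < cos \<theta>" using \<theta> by (intro cos_gt_zero) auto
  have "\<forall>\<^sub>F s in at_left (1::real). s \<in> {0<..<1}"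
    using eventually_at_left_real[of 0 "1::real"] by simp
  then have "\<forall>\<^sub>F s in at_left 1. \<gamma> s \<in> ball 0 1"
    by eventually_elim (rule subsetD[OF img], rule imageI, auto)
  moreover have "\<forall>\<^sub>F s in at_left 1. dist (\<gamma> s) \<zeta> < cos \<theta>"
    using lim cos by (rule tendstoD)
  ultimately have "\<forall>\<^sub>F s in at_left 1. \<gamma> s \<in> ball 0 1 \<and>
      cmod (\<gamma> s - \<zeta>) \<le> 2 / cos \<theta> * (1 - cmod (\<gamma> s))"
    using \<theta>(3)
  proof eventually_elim
    case (elim s)
    define z where "z = \<gamma> s"
    define v where "v = 1 - cnj \<zeta> * z"
    have z1: "cmod z < 1" using elim by (simp add: z_def)
    have "cnj \<zeta> * \<zeta> = 1"
      using assms(2) complex_norm_square[of \<zeta>] by (simp add: mult.commute)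
    then have "v = cnj \<zeta> * (\<zeta> - z)"
      by (simp add: v_def right_diff_distrib)
    then have v: "cmod v = cmod (z - \<zeta>)"
      using assms(2) by (simp add: norm_mult norm_minus_commute)
    have vlt: "cmod v < cos \<theta>"
      using elim v by (simp add: z_def dist_norm)
    have "\<bar>Arg v\<bar> < \<theta>" using elim by (simp add: v_def z_def)
    then have "cos \<theta> \<le> cos \<bar>Arg v\<bar>"
      using \<theta> by (intro cos_monotone_0_pi_le) auto
    then have "cos \<theta> * cmod v \<le> cos (Arg v) * cmod v"
      by (intro mult_right_mono) auto
    also have "\<dots> = Re v"
      using rcis_cmod_Arg[of v] by (metis Re_rcis mult.commute)
    finally have Rev: "cos \<theta> * cmod v \<le> Re v" .
    have "cmod z = cmod (1 - v)"
      using assms(2) by (simp add: v_def norm_mult)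
    then have "(cmod z)\<^sup>2 = (1 - Re v)\<^sup>2 + (Im v)\<^sup>2"
      by (simp add: cmod_power2)
    also have "\<dots> = 1 - 2 * Re v + (cmod v)\<^sup>2"
      by (simp add: cmod_power2 power2_diff)
    also have "\<dots> \<le> 1 - 2 * (cos \<theta> * cmod v) + cos \<theta> * cmod v"
    proof -
      have "(cmod v)\<^sup>2 \<le> cos \<theta> * cmod v"
        using vlt unfolding power2_eq_square by (intro mult_right_mono) auto
      then show ?thesis using Rev by linarith
    qed
    finally have "cos \<theta> * cmod v \<le> 1 - (cmod z)\<^sup>2" by linarith
    also have "\<dots> = (1 - cmod z) * (1 + cmod z)"
      by (simp add: power2_eq_square algebra_simps)
    also have "\<dots> \<le> (1 - cmod z) * 2"
      using z1 by (intro mult_left_mono) auto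
    finally have "cmod (z - \<zeta>) \<le> 2 / cos \<theta> * (1 - cmod z)"
      using cos v by (simp add: field_simps)
    then show ?case using elim by (simp add: z_def)
  qed
  then show thesis by (rule that)
qed

text \<open>The corrections are controlled on one period only; the exceptional null set is spread by
  countably many translations.\<close>

lemma AE_lebesgue_cis:
  assumes "AE t in lebesgue. t \<in> {0..2 * pi} \<longrightarrow> Q (cis t)"
  shows "AE t in lebesgue. Q (cis t)"
proof -
  obtain N where N: "{t \<in> space lebesgue. \<not> (t \<in> {0..2 * pi} \<longrightarrow> Q (cis t))} \<subseteq> N"
    "N \<in> null_sets lebesgue"
    using assms unfolding eventually_ae_filter by blast
  have "negligible (\<Union>k::int. (+) (2 * pi * of_int k) ` N)"
    using N(2) by (intro negligible_countable_Union) (auto simp: negligible_iff_null_sets[symmetric] intro: negligible_translation)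
  moreover have "t \<in> (\<Union>k::int. (+) (2 * pi * of_int k) ` N)" if t: "\<not> Q (cis t)" for t
  proof -
    define k where "k = \<lfloor>t / (2 * pi)\<rfloor>"
    define u where "u = t - 2 * pi * of_int k"
    have "of_int k \<le> t / (2 * pi)" "t / (2 * pi) < of_int k + 1"
      unfolding k_def by linarith+
    then have "u \<in> {0..2 * pi}"
      by (auto simp: u_def field_simps)
    moreover have "cis u = cis t"
      unfolding u_def cis_divide[symmetric] by (simp add: cis_multiple_2pi)
    ultimately have "u \<in> N" using N(1) t by auto
    then show ?thesis
      by (intro UN_I[of k] image_eqI[of _ _ u]) (auto simp: u_def)
  qed
  ultimately show ?thesis
    by (intro AE_I'[of "\<Union>k::int. (+) (2 * pi * of_int k) ` N"])
       (auto simp: negligible_iff_null_sets)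
qed

section \<open>Summation of the corrections and boundary limits\<close>

theorem theorem2p1:
  fixes lam :: "complex \<Rightarrow> complex" and \<phi> :: "complex \<Rightarrow> real"
  assumes "\<And>\<zeta>. cmod \<zeta> = 1 \<Longrightarrow> cmod (lam \<zeta>) = 1"
    and "(\<lambda>t. lam (cis t)) \<in> borel_measurable lebesgue"
    and "(\<lambda>t. \<phi> (cis t)) \<in> borel_measurable lebesgue"
  shows "\<exists>f. f holomorphic_on ball 0 1 \<and>
    (AE t in lebesgue. \<forall>\<gamma>. nontangential_path \<gamma> (cis t) \<longrightarrow>
        ((\<lambda>s. Re (cnj (lam (cis t)) * f (\<gamma> s))) \<longlongrightarrow> \<phi> (cis t)) (at_left 1))"
proof -
  \<comment> \<open>The apertures \<open>A n\<close> grow beyond every Stolz angle, the radii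
    \<open>r n\<close> tend to 1, and the measures \<open>(1 / 2) ^ n\<close> below are
    summable.\<close>
  define A :: "nat \<Rightarrow> real" where "A n = real n + 1" for n
  define r :: "nat \<Rightarrow> real" where "r n = 1 - 1 / (real n + 1)" for n
  define meas :: "(complex \<Rightarrow> complex) \<Rightarrow> bool"
    where "meas g \<longleftrightarrow> (\<lambda>t. g (cis t)) \<in> borel_measurable lebesgue" for g
  define res where "res g t = \<phi> (cis t) - Re (cnj (lam (cis t)) * g (cis t))" for g t
  define stage_ok where "stage_ok n K =
      stolz_correction (A n) ((1 / 2) ^ n) (r n) K (\<lambda>t. lam (cis t))" for n K
  have "\<exists>K>0. \<forall>R \<tau>. R \<in> borel_measurable lebesgue \<longrightarrow> 0 < \<tau> \<longrightarrow> (\<exists>f E. stage_ok n K R \<tau> f E)" for n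
  proof -
    have "1 \<le> A n" "(0::real) < (1 / 2) ^ n" "r n < 1"
      by (auto simp: A_def r_def)
    then show ?thesis
      using stolz_correction_exists[OF _ _ _ assms(2), of "A n" "(1 / 2) ^ n" "r n"] assms(1)
      unfolding stage_ok_def by (metis norm_cis)
  qed
  then obtain K where K: "\<And>n. 0 < K n"
    "\<And>n R \<tau>. R \<in> borel_measurable lebesgue \<Longrightarrow> 0 < \<tau> \<Longrightarrow> \<exists>f E. stage_ok n (K n) R \<tau> f E"
    by metis
  \<comment> \<open>Stage \<open>n\<close> leaves a residual of at most \<open>\<tau> n\<close>,
    which stage \<open>n + 1\<close> multiplies by \<open>K (Suc n)\<close>; the product must still
    be summable.\<close>
  define \<tau> where "\<tau> n = (1 / 2) ^ n / (K (Suc n) + 1)" for n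
  have \<tau>: "0 < \<tau> n" "\<tau> n \<le> (1 / 2) ^ n" "K (Suc n) * \<tau> n \<le> (1 / 2) ^ n" for n
  proof -
    have "0 < K (Suc n) + 1" "1 / (K (Suc n) + 1) \<le> 1" "K (Suc n) / (K (Suc n) + 1) \<le> 1"
      using K(1)[of "Suc n"] by auto
    then show "0 < \<tau> n" "\<tau> n \<le> (1 / 2) ^ n" "K (Suc n) * \<tau> n \<le> (1 / 2) ^ n"
      using mult_left_mono[of "1 / (K (Suc n) + 1)" 1 "(1 / 2) ^ n"]
        mult_left_mono[of "K (Suc n) / (K (Suc n) + 1)" 1 "(1 / 2) ^ n"]
      by (auto simp: \<tau>_def mult.commute)
  qed
  have res_meas: "res g \<in> borel_measurable lebesgue" if "meas g" for g
  proof -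
    have "cnj \<in> borel_measurable borel"
      by (intro borel_measurable_continuous_onI continuous_intros)
    then have "(\<lambda>t. cnj (lam (cis t)) * g (cis t)) \<in> borel_measurable lebesgue"
      using that unfolding meas_def
      by (intro borel_measurable_times measurable_compose[OF assms(2)])
    then show ?thesis
      unfolding res_def using assms(3)
      by (intro borel_measurable_diff measurable_compose[OF _ borel_measurable_Re])
  qed
  \<comment> \<open>Choosing a correction for every \<open>g\<close>, with measurability as a
    premise inside, allows the partial sums to be defined by plain recursion before they are known
    to be measurable.\<close>
  have "\<forall>n g. \<exists>f E. meas g \<longrightarrow> stage_ok n (K n) (res g) (\<tau> n) f E"
    using K(2) res_meas \<tau>(1) by meson
  then obtain F E' where FE: "\<And>n g. meas g \<Longrightarrow> stage_ok n (K n) (res g) (\<tau> n) (F n g) (E' n g)"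
    by metis
  define G where "G = rec_nat (\<lambda>z. 0) (\<lambda>n g z. g z + F n g z)"
  define f where "f n = F n (G n)" for n
  define E where "E n = E' n (G n)" for n
  have G0: "G 0 = (\<lambda>z. 0)" and GS: "G (Suc n) = (\<lambda>z. G n z + f n z)" for n
    by (simp_all add: G_def f_def)
  have Gm: "meas (G n)" for n
  proof (induction n)
    case (Suc n)
    have "meas (f n)"
      using FE[OF Suc] by (simp add: stage_ok_def stolz_correction_def meas_def f_def)
    then show ?case
      using Suc by (simp add: GS meas_def)
  qed (simp add: G0 meas_def)
  have Gsum: "G n = (\<lambda>z. \<Sum>k<n. f k z)" for n
    by (induction n) (simp_all add: G0 GS)
  then have G_eq: "G = (\<lambda>n z. \<Sum>k<n. f k z)" by blast
  have ok: "stage_ok n (K n) (res (G n)) (\<tau> n) (f n) (E n)" for n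
    unfolding f_def E_def by (rule FE[OF Gm])
  have hol: "f n holomorphic_on ball 0 1" and cont: "negligible {t. \<not> isCont (f n) (cis t)}"
    and small: "\<And>z. cmod z \<le> r n \<Longrightarrow> cmod (f n z) \<le> \<tau> n"
    and E: "E n \<in> lmeasurable" "measure lebesgue (E n) \<le> (1 / 2) ^ n" for n
    using ok[of n] by (auto simp: stage_ok_def stolz_correction_def)
  have res_small: "\<bar>res (G (Suc n)) t\<bar> \<le> \<tau> n" if "t \<in> {0..2 * pi} - E n" for n t
    using ok[of n] that by (simp add: stage_ok_def stolz_correction_def res_def GS algebra_simps)
  have f_bound: "cmod (f n z) \<le> K n * \<bar>res (G n) t\<bar> + \<tau> n"
    if "t \<in> {0..2 * pi} - E n" "z \<in> ball 0 1" "cmod (z - cis t) \<le> A n * (1 - cmod z)" for n t z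
    using ok[of n] that by (simp add: stage_ok_def stolz_correction_def)
  define h where "h z = (\<Sum>n. f n z)" for z
  have "h holomorphic_on ball 0 1"
  proof (rule holomorphic_uniform_sequence)
    show "G n holomorphic_on ball 0 1" for n
      unfolding Gsum by (intro holomorphic_intros hol)
    fix x :: complex assume x: "x \<in> ball 0 1"
    define d where "d = (1 - cmod x) / 2"
    have d: "0 < d" using x by (simp add: d_def)
    have near: "cmod z \<le> 1 - d" if "z \<in> cball x d" for z
      using that norm_triangle_ineq2[of z x] by (simp add: d_def dist_norm norm_minus_commute field_simps)
    \<comment> \<open>The bound \<open>small\<close> covers the ball only once
      \<open>r n \<ge> 1 - d\<close>, hence the eventual form of the M-test.\<close>
    have "uniform_limit (cball x d) (\<lambda>n z. \<Sum>k<n. f k z) (\<lambda>z. \<Sum>k. f k z) sequentially"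
    proof (rule Weierstrass_m_test_ev)
      show "summable (\<lambda>n. (1 / 2 :: real) ^ n)" by simp
      have "(\<lambda>n. 1 / (real n + 1)) \<longlonglongrightarrow> 0"
        using LIMSEQ_inverse_real_of_nat by (simp add: inverse_eq_divide add.commute)
      then have "\<forall>\<^sub>F n in sequentially. 1 / (real n + 1) < d"
        using d by (rule order_tendstoD)
      then show "\<forall>\<^sub>F n in sequentially. \<forall>z\<in>cball x d. cmod (f n z) \<le> (1 / 2) ^ n"
      proof eventually_elim
        case (elim n)
        show ?case
        proof
          fix z assume "z \<in> cball x d"
          then have "cmod z \<le> r n"
            using near elim by (fastforce simp: r_def)
          then show "cmod (f n z) \<le> (1 / 2) ^ n"
            using small \<tau>(2) order_trans by blast
        qed
      qed
    qed
    then have "uniform_limit (cball x d) G h sequentially"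
      unfolding h_def G_eq .
    moreover have "cball x d \<subseteq> ball 0 1"
      using d near by force
    ultimately show "\<exists>d>0. cball x d \<subseteq> ball 0 1 \<and> uniform_limit (cball x d) G h sequentially"
      using d by blast
  qed simp
  moreover have "AE t in lebesgue. \<forall>\<gamma>. nontangential_path \<gamma> (cis t) \<longrightarrow>
        ((\<lambda>s. Re (cnj (lam (cis t)) * h (\<gamma> s))) \<longlongrightarrow> \<phi> (cis t)) (at_left 1)"
  proof (rule AE_lebesgue_cis)
    \<comment> \<open>Borel-Cantelli: almost every \<open>t\<close> lies in only finitely many
      exceptional sets.\<close>
    have "AE t in lebesgue. \<forall>\<^sub>F n in sequentially. t \<in> space lebesgue - E n"
    proof (rule borel_cantelli_AE1)
      show "E n \<in> sets lebesgue" "emeasure lebesgue (E n) < \<infinity>" for n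
        using E(1)[of n] by (auto simp: fmeasurable_def)
      show "summable (\<lambda>n. measure lebesgue (E n))"
        by (rule summable_comparison_test'[of "\<lambda>n. (1 / 2) ^ n" 0]) (auto simp: E)
    qed
    moreover have "AE t in lebesgue. \<forall>n. isCont (f n) (cis t)"
      unfolding AE_all_countable
    proof
      fix n
      show "AE t in lebesgue. isCont (f n) (cis t)"
        using cont[of n] by (intro AE_I'[of "{t. \<not> isCont (f n) (cis t)}"])
          (auto simp: negligible_iff_null_sets)
    qed
    ultimately show "AE t in lebesgue. t \<in> {0..2 * pi} \<longrightarrow> (\<forall>\<gamma>. nontangential_path \<gamma> (cis t) \<longrightarrow>
        ((\<lambda>s. Re (cnj (lam (cis t)) * h (\<gamma> s))) \<longlongrightarrow> \<phi> (cis t)) (at_left 1))"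
    proof (eventually_elim, intro impI allI)
      fix t \<gamma>
      assume ev: "\<forall>\<^sub>F n in sequentially. t \<in> space lebesgue - E n"
        and fc: "\<forall>n. isCont (f n) (cis t)" and t: "t \<in> {0..2 * pi}"
        and \<gamma>: "nontangential_path \<gamma> (cis t)"
      obtain C where C: "\<forall>\<^sub>F s in at_left 1. \<gamma> s \<in> ball 0 1 \<and>
          cmod (\<gamma> s - cis t) \<le> C * (1 - cmod (\<gamma> s))"
        using nontangential_path_stolz[OF \<gamma>] by auto
      have lim\<gamma>: "(\<gamma> \<longlongrightarrow> cis t) (at_left 1)"
        using \<gamma> by (simp add: nontangential_path_def)
      let ?S = "{z \<in> ball 0 1. cmod (z - cis t) \<le> C * (1 - cmod z)}"
      let ?L = "\<lambda>w. Re (cnj (lam (cis t)) * w)"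
      obtain n0 where n0: "\<And>n. n0 \<le> n \<Longrightarrow> t \<notin> E n"
        using ev unfolding eventually_sequentially by auto
      have res0: "(\<lambda>n. res (G (Suc n)) t) \<longlonglongrightarrow> 0"
      proof (rule Lim_null_comparison)
        show "\<forall>\<^sub>F n in sequentially. norm (res (G (Suc n)) t) \<le> (1 / 2) ^ n"
          using eventually_ge_at_top[of n0]
        proof eventually_elim
          case (elim n)
          then show ?case
            using res_small[of t n] n0 t \<tau>(2)[of n] by simp
        qed
        show "(\<lambda>n. (1 / 2 :: real) ^ n) \<longlonglongrightarrow> 0"
          by (rule LIMSEQ_realpow_zero) auto
      qed
      have "(\<lambda>n. ?L (G (Suc n) (cis t))) \<longlonglongrightarrow> \<phi> (cis t)"
        using tendsto_diff[OF tendsto_const[of "\<phi> (cis t)"] res0] by (simp add: res_def)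
      then have Glim: "(\<lambda>n. ?L (G n (cis t))) \<longlonglongrightarrow> \<phi> (cis t)"
        by (rule LIMSEQ_imp_Suc)
      have "uniform_limit ?S (\<lambda>n z. \<Sum>k<n. f k z) (\<lambda>z. \<Sum>k. f k z) sequentially"
      proof (rule Weierstrass_m_test_ev)
        show "summable (\<lambda>n. 3 * (1 / 2 :: real) ^ n)"
          by (intro summable_mult) simp
        \<comment> \<open>\<open>C\<close> depends on the path, but \<open>A n\<close> eventually
          exceeds it, so the null set serves all paths. The successor is there because the bound on
          \<open>f n\<close> uses the residual left by stage \<open>n - 1\<close>, so
          \<open>t\<close> must avoid that exceptional set too.\<close>
        have "\<forall>\<^sub>F n in sequentially. C \<le> A n \<and> Suc n0 \<le> n"
        proof (rule eventually_conj)
          show "\<forall>\<^sub>F n in sequentially. C \<le> A n"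
            using eventually_ge_at_top[of "nat \<lceil>C\<rceil>"]
            by eventually_elim (simp add: A_def nat_ceiling_le_eq)
        qed (rule eventually_ge_at_top)
        then show "\<forall>\<^sub>F n in sequentially. \<forall>z\<in>?S. cmod (f n z) \<le> 3 * (1 / 2) ^ n"
        proof eventually_elim
          case (elim n)
          then obtain m where m: "n = Suc m" "n0 \<le> m"
            by (metis Suc_le_D Suc_le_mono)
          have "K n * \<bar>res (G n) t\<bar> \<le> K n * \<tau> m"
            using res_small[of t m] n0 t m K(1)[of n] by (intro mult_left_mono) auto
          also have "\<dots> \<le> (1 / 2) ^ m"
            using \<tau>(3) m by simp
          finally have Kr: "K n * \<bar>res (G n) t\<bar> \<le> 2 * (1 / 2) ^ n"
            using m by simp
          show ?case
          proof
            fix z assume z: "z \<in> ?S"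
            have "C * (1 - cmod z) \<le> A n * (1 - cmod z)"
              using z elim by (intro mult_right_mono) auto
            then have "cmod (z - cis t) \<le> A n * (1 - cmod z)"
              using z by (auto intro: order_trans)
            then have "cmod (f n z) \<le> K n * \<bar>res (G n) t\<bar> + \<tau> n"
              using z t n0 elim by (intro f_bound) auto
            then show "cmod (f n z) \<le> 3 * (1 / 2) ^ n"
              using Kr \<tau>(2)[of n] by simp
          qed
        qed
      qed
      then have "uniform_limit ?S G h sequentially"
        unfolding h_def G_eq .
      then have ul: "uniform_limit ?S (\<lambda>n z. ?L (G n z)) (\<lambda>z. ?L (h z)) sequentially"
        by (intro bounded_linear.uniform_limit[OF bounded_linear_compose[OF bounded_linear_Re bounded_linear_mult_right]])
      have Gcont: "isCont (G n) (cis t)" for n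
        unfolding Gsum using fc by (intro continuous_intros) auto
      show "((\<lambda>s. ?L (h (\<gamma> s))) \<longlongrightarrow> \<phi> (cis t)) (at_left 1)"
      \<comment> \<open>Interchange of limits: each partial sum is continuous at
        \<open>cis t\<close>, convergence is uniform along the part of the path in the Stolz region,
        and the boundary values tend to \<open>\<phi> (cis t)\<close>.\<close>
      proof (rule swap_uniform_limit'[of "\<lambda>n s. ?L (G n (\<gamma> s))" "\<lambda>n. ?L (G n (cis t))"
            _ sequentially _ "{s. \<gamma> s \<in> ?S}"])
        show "\<forall>\<^sub>F n in sequentially. ((\<lambda>s. ?L (G n (\<gamma> s))) \<longlongrightarrow> ?L (G n (cis t))) (at_left 1)"
          using isCont_tendsto_compose[OF Gcont lim\<gamma>]
          by (intro always_eventually allI tendsto_intros)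
        show "uniform_limit {s. \<gamma> s \<in> ?S} (\<lambda>n s. ?L (G n (\<gamma> s))) (\<lambda>s. ?L (h (\<gamma> s))) sequentially"
          by (rule uniform_limit_compose'[OF ul]) auto
        show "\<forall>\<^sub>F s in at_left 1. s \<in> {s. \<gamma> s \<in> ?S}"
          using C by simp
      qed (use Glim in auto)
    qed
  qed
  ultimately show ?thesis by blast
qed

end
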